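(* Let $X$ be a Banach space and let $Y \subset X$ be an $M$-ideal in $X$. If $X$ has the ball huskable property ($BHP$), then $Y$ has $BHP$.
   Context: All Banach spaces (including the subspace $Y$) are real and nontrivial ($\neq \{0\}$). $B_X$ denotes the closed unit ball of $X$, $X^*$ the dual of $X$. $M$-ideal: for a closed subspace $Y \subset X$ let $Y^\perp = \{x^* \in X^* : x^*(y) = 0 \ \forall y \in Y\}$. A linear projection $P$ on a Banach space $Z$ is an $L$-projection if $\|z\| = \|Pz\| + \|z - Pz\|$ for all $z \in Z$. A closed subspace $Y \subset X$ is an $M$-ideal in $X$ if there is an $L$-projection $P : X^* \to X^*$ with $\ker P = Y^\perp$. Ball huskable property: a Banach space $X$ has $BHP$ if for every $\varepsilon > 0$ there is a nonempty relatively weakly open subset of $B_X$ with (norm) diameter less than $\varepsilon$. *)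

theory Defs
  imports "HOL-Analysis.Analysis"
begin

text \<open>The dual of a subspace \<open>S\<close> carrying the inherited norm: functions that are linear and bounded
  on \<open>S\<close>. Values outside \<open>S\<close> are unconstrained, so a functional on \<open>S\<close> is represented by all its
  extensions to functions on the whole type; this does not affect the weak topology of \<open>S\<close>.\<close>

definition dual_on :: "'a::real_normed_vector set \<Rightarrow> ('a \<Rightarrow> real) set" where
  "dual_on S = {f. (\<forall>x\<in>S. \<forall>y\<in>S. f (x + y) = f x + f y) \<and>
                   (\<forall>c. \<forall>x\<in>S. f (c *\<^sub>R x) = c * f x) \<and>
                   (\<exists>K. \<forall>x\<in>S. \<bar>f x\<bar> \<le> K * norm x)}"

definition weak_topology_on :: "'a::real_normed_vector set \<Rightarrow> 'a topology" where
  "weak_topology_on S =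
     topology_generated_by {{x \<in> S. f x \<in> V} | f V. f \<in> dual_on S \<and> open V}"

text \<open>\<open>BHP S\<close> concerns the subspace \<open>S\<close> as a space in its own right, with its own dual, weak
  topology and unit ball; the whole space \<open>X\<close> is the case \<open>S = UNIV\<close>.\<close>

definition BHP :: "'a::real_normed_vector set \<Rightarrow> bool" where
  "BHP S \<longleftrightarrow> (\<forall>\<epsilon>>0. \<exists>U. openin (subtopology (weak_topology_on S) (S \<inter> cball 0 1)) U \<and>
                          U \<noteq> {} \<and> diameter U < \<epsilon>)"

definition annihilator :: "'a::real_normed_vector set \<Rightarrow> ('a \<Rightarrow>\<^sub>L real) set" where
  "annihilator Y = {f. \<forall>y\<in>Y. blinfun_apply f y = 0}"

definition L_projection :: "('b::real_normed_vector \<Rightarrow> 'b) \<Rightarrow> bool" where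
  "L_projection P \<longleftrightarrow> linear P \<and> P \<circ> P = P \<and> (\<forall>z. norm z = norm (P z) + norm (z - P z))"

definition M_ideal :: "'a::real_normed_vector set \<Rightarrow> bool" where
  "M_ideal Y \<longleftrightarrow> subspace Y \<and> closed Y \<and>
     (\<exists>P :: ('a \<Rightarrow>\<^sub>L real) \<Rightarrow> ('a \<Rightarrow>\<^sub>L real). L_projection P \<and> {f. P f = 0} = annihilator Y)"

lemma dual_on_UNIV: "dual_on (UNIV :: 'a::real_normed_vector set) = {f. bounded_linear f}"
  by (auto simp: dual_on_def bounded_linear_def bounded_linear_axioms_def linear_iff mult.commute)

lemma topspace_weak_topology_on: "topspace (weak_topology_on S) = S"
proof -
  have "(\<lambda>_. 0) \<in> dual_on S"
    by (auto simp: dual_on_def intro: exI[of _ 0])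
  then have "{x \<in> S. (\<lambda>_. 0::real) x \<in> UNIV}
      \<in> {{x \<in> S. f x \<in> V} | f V. f \<in> dual_on S \<and> open V}"
    by blast
  then show ?thesis
    by (auto simp: weak_topology_on_def topology_generated_by_topspace)
qed

end

theory Submission imports Defs begin

text \<open>
  Let \<open>P\<close> be the \<open>L\<close>-projection on the dual with kernel
  \<open>annihilator Y\<close>, and let \<open>U\<close> be a relatively weakly open subset of the ball of \<open>X\<close> containing
  \<open>x\<^sub>0\<close> and cut out near \<open>x\<^sub>0\<close> by finitely many functionals \<open>f \<in> F\<close>. Dualising \<open>P\<close> splits the
  bidual as an \<open>\<ell>\<^sub>\<infinity>\<close>-sum whose first summand is the bidual of \<open>Y\<close>. So the component of \<open>x\<^sub>0\<close>
  in the bidual of \<open>Y\<close> has norm at most \<open>1\<close> and, by Goldstine, is weak* close on \<open>F\<close> to some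
  point of the ball of \<open>Y\<close>; the set \<open>W\<close> of all such points is relatively weakly open.
  Replacing that component of \<open>x\<^sub>0\<close> by any \<open>y \<in> W\<close> gives an element \<open>\<Phi>\<^sub>y\<close> of the unit ball of the
  bidual which on \<open>F\<close> is still close to \<open>x\<^sub>0\<close>. Hence \<open>\<Phi>\<^sub>y\<close> is a weak* limit of points of \<open>U\<close>.
  As \<open>\<Phi>\<^sub>y - \<Phi>\<^sub>z = y - z\<close> and the norm is weak* lower semicontinuous, the diameter of
  \<open>W\<close> is at most that of \<open>U\<close>.

  The bidual never has to be formed: its elements appear as linear forms on the dual, and the
  only input about them is the approximation lemma \<open>bipolar_approximation\<close>, which serves both for
  the ball of \<open>X\<close> and for the ball of \<open>Y\<close>. Lower semicontinuity comes from
  \<open>norming_functional\<close>; that \<open>P f\<close> is no larger than the restriction of \<open>f\<close> to \<open>Y\<close>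
  comes from \<open>norm_preserving_extension\<close>. Both are instances of the Hahn-Banach theorem
  \<open>sublinear_sandwich\<close>.
\<close>

section \<open>The Hahn-Banach theorem for sublinear functionals\<close>

definition sublinear :: "('a::real_vector \<Rightarrow> real) \<Rightarrow> bool" where
  "sublinear p \<longleftrightarrow> (\<forall>x y. p (x + y) \<le> p x + p y) \<and> (\<forall>c\<ge>0. \<forall>x. p (c *\<^sub>R x) = c * p x)"

lemma sublinear_add: "sublinear p \<Longrightarrow> p (x + y) \<le> p x + p y"
  and sublinear_scale: "sublinear p \<Longrightarrow> c \<ge> 0 \<Longrightarrow> p (c *\<^sub>R x) = c * p x"
  by (auto simp: sublinear_def)

lemma sublinear_zero: "sublinear p \<Longrightarrow> p 0 = 0"
  using sublinear_scale[of p 0 0] by simp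

lemma sublinear_lower: "sublinear p \<Longrightarrow> - p (- x) \<le> p x"
  using sublinear_add[of p x "- x"] by (simp add: sublinear_zero)

text \<open>For positive scalars an inequality is enough, since it can be applied to the inverse scalar.\<close>

lemma sublinearI:
  assumes add: "\<And>x y. p (x + y) \<le> p x + p y"
    and zero: "p 0 = 0"
    and scale: "\<And>c x. c > 0 \<Longrightarrow> p (c *\<^sub>R x) \<le> c * p x"
  shows "sublinear p"
proof -
  have "p (c *\<^sub>R x) = c * p x" if "c \<ge> 0" for c x
  proof (cases "c = 0")
    case False
    then have c: "c > 0" using that by simp
    have "p (inverse c *\<^sub>R (c *\<^sub>R x)) \<le> inverse c * p (c *\<^sub>R x)"
      using c by (intro scale) simp
    then have "c * p x \<le> p (c *\<^sub>R x)"
      using c by (simp add: field_simps)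
    with scale[OF c, of x] show ?thesis by simp
  qed (simp add: zero)
  then show ?thesis using add by (simp add: sublinear_def)
qed

lemma sublinear_norm_scaled: "M \<ge> 0 \<Longrightarrow> sublinear (\<lambda>x. M * norm x)"
  unfolding sublinear_def
  by (auto simp: distrib_left[symmetric] intro!: mult_left_mono norm_triangle_ineq)

text \<open>Here \<open>K\<close> is a convex cone. Cones rather than subspaces, and superadditive rather than linear
  \<open>l\<close>, make one construction serve twice: a subspace with a linear \<open>l\<close> gives extension theorems, and
  a ray with \<open>l = p\<close> gives functionals that attain \<open>p\<close> at a given point.\<close>

definition superadditive_below :: "'a::real_vector set \<Rightarrow> ('a \<Rightarrow> real) \<Rightarrow> ('a \<Rightarrow> real) \<Rightarrow> bool" where
  "superadditive_below K l p \<longleftrightarrow>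
     0 \<in> K \<and> l 0 = 0 \<and>
     (\<forall>x\<in>K. \<forall>y\<in>K. x + y \<in> K \<and> l x + l y \<le> l (x + y)) \<and>
     (\<forall>c>0. \<forall>x\<in>K. c *\<^sub>R x \<in> K \<and> l (c *\<^sub>R x) = c * l x) \<and>
     (\<forall>x\<in>K. l x \<le> p x)"

text \<open>The key construction. Lowering \<open>p\<close> to the infimal convolution
  \<open>inf k\<in>K. p (x + k) - l k\<close> keeps it sublinear and forces the value at \<open>- k\<close> down to \<open>- l k\<close>, so
  that any linear functional below the result dominates \<open>l\<close> on \<open>K\<close>.\<close>

lemma lower_sublinear:
  assumes p: "sublinear p" and K: "superadditive_below K l p"
  obtains q where "sublinear q" "\<And>x. q x \<le> p x" "\<And>k. k \<in> K \<Longrightarrow> q (- k) \<le> - l k"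
proof -
  have K0: "0 \<in> K" "l 0 = 0"
    and Kadd: "\<And>x y. x \<in> K \<Longrightarrow> y \<in> K \<Longrightarrow> x + y \<in> K \<and> l x + l y \<le> l (x + y)"
    and Kscale: "\<And>c x. c > 0 \<Longrightarrow> x \<in> K \<Longrightarrow> c *\<^sub>R x \<in> K \<and> l (c *\<^sub>R x) = c * l x"
    and Kp: "\<And>x. x \<in> K \<Longrightarrow> l x \<le> p x"
    using K unfolding superadditive_below_def by blast+
  define q where "q x = (INF k\<in>K. p (x + k) - l k)" for x
  have below: "- p (- x) \<le> p (x + k) - l k" if "k \<in> K" for x k
    using sublinear_add[OF p, of "x + k" "- x"] Kp[OF that] by simp
  have qle: "q x \<le> p (x + k) - l k" if "k \<in> K" for x k
    unfolding q_def using that below by (intro cINF_lower bdd_belowI2) auto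
  have qge: "m \<le> q x" if "\<And>k. k \<in> K \<Longrightarrow> m \<le> p (x + k) - l k" for m x
    unfolding q_def using that K0 by (intro cINF_greatest) auto
  have "sublinear q"
  proof (rule sublinearI)
    fix x y
    have step: "q (x + y) - (p (y + k') - l k') \<le> q x" if k': "k' \<in> K" for k'
    proof (rule qge)
      fix k assume k: "k \<in> K"
      have "q (x + y) \<le> p ((x + y) + (k + k')) - l (k + k')"
        using Kadd[OF k k'] by (intro qle) simp
      also have "(x + y) + (k + k') = (x + k) + (y + k')" by simp
      also have "p \<dots> \<le> p (x + k) + p (y + k')" by (rule sublinear_add[OF p])
      finally show "q (x + y) - (p (y + k') - l k') \<le> p (x + k) - l k"
        using Kadd[OF k k'] by simp
    qed
    have "q (x + y) - q x \<le> q y"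
    proof (rule qge)
      fix k assume "k \<in> K"
      from step[OF this] show "q (x + y) - q x \<le> p (y + k) - l k" by linarith
    qed
    then show "q (x + y) \<le> q x + q y" by simp
  next
    have "q 0 \<le> 0" using qle[OF K0(1), of 0] K0 sublinear_zero[OF p] by simp
    moreover have "0 \<le> q 0" using Kp by (intro qge) simp
    ultimately show "q 0 = 0" by simp
  next
    fix c :: real and x assume c: "c > 0"
    have "q (c *\<^sub>R x) / c \<le> q x"
    proof (rule qge)
      fix k assume k: "k \<in> K"
      have "q (c *\<^sub>R x) \<le> p (c *\<^sub>R x + c *\<^sub>R k) - l (c *\<^sub>R k)"
        using Kscale[OF c k] by (intro qle) simp
      also have "\<dots> = c * (p (x + k) - l k)"
        using Kscale[OF c k] sublinear_scale[OF p, of c "x + k"] c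
        by (simp add: scaleR_add_right right_diff_distrib)
      finally show "q (c *\<^sub>R x) / c \<le> p (x + k) - l k"
        using c by (simp add: field_simps)
    qed
    then show "q (c *\<^sub>R x) \<le> c * q x" using c by (simp add: field_simps)
  qed
  moreover have "q x \<le> p x" for x using qle[OF K0(1), of x] K0 by simp
  moreover have "q (- k) \<le> - l k" if "k \<in> K" for k
    using qle[OF that, of "- k"] sublinear_zero[OF p] by simp
  ultimately show ?thesis using that by blast
qed

lemma superadditive_below_ray:
  assumes p: "sublinear p"
  shows "superadditive_below {t *\<^sub>R a |t. t \<ge> 0} p p"
  unfolding superadditive_below_def
proof (intro conjI ballI allI impI)
  show "0 \<in> {t *\<^sub>R a |t. t \<ge> 0}" by (auto intro: exI[of _ 0])
  show "p 0 = 0" by (rule sublinear_zero[OF p])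
next
  fix x y assume "x \<in> {t *\<^sub>R a |t. t \<ge> 0}" "y \<in> {t *\<^sub>R a |t. t \<ge> 0}"
  then obtain s t where st: "s \<ge> 0" "t \<ge> 0" "x = s *\<^sub>R a" "y = t *\<^sub>R a" by blast
  then have sum: "x + y = (s + t) *\<^sub>R a" by (simp add: scaleR_add_left)
  show "x + y \<in> {t *\<^sub>R a |t. t \<ge> 0}"
    unfolding sum using st by (intro CollectI exI[of _ "s + t"]) simp
  show "p x + p y \<le> p (x + y)"
    unfolding sum unfolding st(3,4) using st(1,2)
    by (simp add: sublinear_scale[OF p] distrib_right)
next
  fix c :: real and x assume c: "c > 0" and "x \<in> {t *\<^sub>R a |t. t \<ge> 0}"
  then obtain t where "t \<ge> 0" "x = t *\<^sub>R a" by blast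
  then show "c *\<^sub>R x \<in> {t *\<^sub>R a |t. t \<ge> 0}"
    using c by (intro CollectI exI[of _ "c * t"]) simp
  show "p (c *\<^sub>R x) = c * p x" using c by (simp add: sublinear_scale[OF p])
qed simp

text \<open>Lowering a minimal \<open>p\<close> along the ray through \<open>a\<close> changes nothing, which gives
  \<open>p (- a) \<le> - p a\<close>; a sublinear function that is odd is linear.\<close>

lemma minimal_sublinear_linear:
  assumes p: "sublinear p"
    and min: "\<And>q. sublinear q \<Longrightarrow> (\<And>x. q x \<le> p x) \<Longrightarrow> q = p"
  shows "linear p"
proof -
  have odd: "p (- a) = - p a" for a
  proof -
    obtain q where q: "sublinear q" "\<And>x. q x \<le> p x"
      "\<And>k. k \<in> {t *\<^sub>R a |t. t \<ge> 0} \<Longrightarrow> q (- k) \<le> - p k"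
      using lower_sublinear[OF p superadditive_below_ray[OF p, of a]] by blast
    have "q = p" using q min by blast
    moreover have "a \<in> {t *\<^sub>R a |t. t \<ge> 0}"
      by (intro CollectI exI[of _ 1]) simp
    ultimately have "p (- a) \<le> - p a" using q(3) by blast
    with sublinear_lower[OF p, of a] show ?thesis by simp
  qed
  show ?thesis
  proof (rule linearI)
    fix x y
    show "p (x + y) = p x + p y"
      using sublinear_add[OF p, of x y] sublinear_add[OF p, of "- x" "- y"]
        odd[of x] odd[of y] odd[of "x + y"] by simp
  next
    fix c x
    show "p (c *\<^sub>R x) = c *\<^sub>R p x"
    proof (cases "c \<ge> 0")
      case False
      then show ?thesis
        using sublinear_scale[OF p, of "- c" x] odd[of "c *\<^sub>R x"] by simp
    qed (simp add: sublinear_scale[OF p])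
  qed
qed

text \<open>Zorn's lemma applies because all sublinear functions below \<open>q\<close> are bounded below at \<open>x\<close> by
  \<open>- q (- x)\<close>, so the pointwise infimum of a chain is again one of them.\<close>

lemma linear_below_sublinear:
  assumes q: "sublinear q"
  obtains f where "linear f" "\<And>x. f x \<le> q x"
proof -
  define A where "A = {p. sublinear p \<and> p \<le> q}"
  have "\<exists>m\<in>A. \<forall>a\<in>A. a \<le> m \<longrightarrow> a = m"
  proof (rule predicate_Zorn)
    show "partial_order_on A (relation_of (\<lambda>a b. b \<le> a) A)"
      by (rule partial_order_on_relation_ofI) auto
  next
    fix C assume C: "C \<in> Chains (relation_of (\<lambda>a b. b \<le> a) A)"
    then have CA: "C \<subseteq> A" by (rule Chains_relation_of)
    have total: "a \<le> b \<or> b \<le> a" if "a \<in> C" "b \<in> C" for a b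
      using C that unfolding Chains_def relation_of_def by auto
    show "\<exists>u\<in>A. \<forall>a\<in>C. u \<le> a"
    proof (cases "C = {}")
      case True
      then show ?thesis using q by (auto simp: A_def)
    next
      case False
      then obtain p\<^sub>0 where p0: "p\<^sub>0 \<in> C" by blast
      define u where "u x = (INF p\<in>C. p x)" for x
      have sub: "sublinear p" and pq: "p x \<le> q x" if "p \<in> C" for p x
        using that CA by (auto simp: A_def le_fun_def)
      have "- q (- x) \<le> p x" if "p \<in> C" for p x
        using sublinear_lower[OF sub[OF that], of x] pq[OF that, of "- x"] by simp
      then have ule: "u x \<le> p x" if "p \<in> C" for p x
        unfolding u_def using that by (intro cINF_lower bdd_belowI2) auto
      have uge: "m \<le> u x" if "\<And>p. p \<in> C \<Longrightarrow> m \<le> p x" for m x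
        unfolding u_def using that False by (intro cINF_greatest) auto
      have "sublinear u"
      proof (rule sublinearI)
        fix x y
        have step: "u (x + y) - p' y \<le> u x" if p': "p' \<in> C" for p'
        proof (rule uge)
          fix p assume pC: "p \<in> C"
          (* Evaluate at the smaller of the two members of the chain. *)
          have "\<exists>r\<in>C. r x \<le> p x \<and> r y \<le> p' y"
            using total[OF pC p'] pC p' by (auto simp: le_fun_def)
          then obtain r where r: "r \<in> C" "r x \<le> p x" "r y \<le> p' y" by blast
          have "u (x + y) \<le> r (x + y)" by (rule ule[OF r(1)])
          also have "\<dots> \<le> r x + r y" by (rule sublinear_add[OF sub[OF r(1)]])
          finally show "u (x + y) - p' y \<le> p x" using r by simp
        qed
        have "u (x + y) - u x \<le> u y"
        proof (rule uge)
          fix p assume "p \<in> C"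
          from step[OF this] show "u (x + y) - u x \<le> p y" by linarith
        qed
        then show "u (x + y) \<le> u x + u y" by simp
      next
        show "u 0 = 0"
          using ule[OF p0, of 0] uge[of 0 0] sublinear_zero[OF sub] p0 by force
      next
        fix c :: real and x assume c: "c > 0"
        have "u (c *\<^sub>R x) / c \<le> u x"
        proof (rule uge)
          fix p assume pC: "p \<in> C"
          show "u (c *\<^sub>R x) / c \<le> p x"
            using ule[OF pC, of "c *\<^sub>R x"] sublinear_scale[OF sub[OF pC], of c x] c
            by (simp add: field_simps)
        qed
        then show "u (c *\<^sub>R x) \<le> c * u x" using c by (simp add: field_simps)
      qed
      moreover have "u \<le> q"
        using ule[OF p0] pq[OF p0] by (auto simp: le_fun_def intro: order_trans)
      ultimately show ?thesis
        using ule by (auto simp: A_def le_fun_def)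
    qed
  qed
  then obtain m where m: "m \<in> A" "\<And>a. a \<in> A \<Longrightarrow> a \<le> m \<Longrightarrow> a = m" by blast
  have "linear m"
  proof (rule minimal_sublinear_linear)
    show "sublinear m" using m by (simp add: A_def)
    fix r assume "sublinear r" "\<And>x. r x \<le> m x"
    then show "r = m" using m by (intro m(2)) (auto simp: A_def le_fun_def intro: order_trans)
  qed
  then show ?thesis using that m by (auto simp: A_def le_fun_def)
qed

theorem sublinear_sandwich:
  assumes "sublinear p" and "superadditive_below K l p"
  obtains f where "linear f" "\<And>x. f x \<le> p x" "\<And>k. k \<in> K \<Longrightarrow> l k \<le> f k"
proof -
  obtain q where q: "sublinear q" "\<And>x. q x \<le> p x" "\<And>k. k \<in> K \<Longrightarrow> q (- k) \<le> - l k"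
    using lower_sublinear[OF assms] by blast
  obtain f where f: "linear f" "\<And>x. f x \<le> q x"
    using linear_below_sublinear[OF q(1)] by blast
  have "l k \<le> f k" if "k \<in> K" for k
    using f(2)[of "- k"] q(3)[OF that] linear_neg[OF f(1), of k] by simp
  moreover have "f x \<le> p x" for x using f(2) q(2) order_trans by blast
  ultimately show ?thesis using that f(1) by blast
qed

section \<open>Bounded functionals on normed spaces\<close>

lemma blinfun_apply_le_of_unit_ball:
  fixes h :: "'a::real_normed_vector \<Rightarrow>\<^sub>L real"
  assumes S: "subspace S"
    and le: "\<And>y. y \<in> S \<Longrightarrow> norm y \<le> 1 \<Longrightarrow> blinfun_apply h y \<le> M"
    and y: "y \<in> S"
  shows "blinfun_apply h y \<le> M * norm y"
proof (cases "y = 0")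
  case False
  have "blinfun_apply h (inverse (norm y) *\<^sub>R y) \<le> M"
    using False by (intro le subspace_scale[OF S y]) auto
  then show ?thesis using False by (simp add: blinfun.scaleR_right field_simps)
qed (simp add: blinfun.zero_right)

lemma blinfun_of_linear_le_norm:
  fixes f :: "'a::real_normed_vector \<Rightarrow> real"
  assumes "linear f" and "\<And>x. f x \<le> M * norm x" and "M \<ge> 0"
  obtains g :: "'a \<Rightarrow>\<^sub>L real" where "\<And>x. blinfun_apply g x = f x" "norm g \<le> M"
proof -
  have bound: "norm (f x) \<le> M * norm x" for x
    using assms(2)[of x] assms(2)[of "- x"] linear_neg[OF assms(1), of x] by (simp add: abs_le_iff)
  have "bounded_linear f"
  proof (rule bounded_linear_intro)
    show "norm (f x) \<le> norm x * M" for x using bound[of x] by (simp only: mult.commute)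
  qed (simp_all add: linear_add[OF assms(1)] linear_cmul[OF assms(1)])
  then have "blinfun_apply (Blinfun f) = f" by (rule bounded_linear_Blinfun_apply)
  then show ?thesis
    using that[of "Blinfun f"] norm_blinfun_bound[OF assms(3), of "Blinfun f"] bound by simp
qed

lemma norming_functional:
  fixes a :: "'a::real_normed_vector"
  obtains g :: "'a \<Rightarrow>\<^sub>L real" where "norm g \<le> 1" "blinfun_apply g a = norm a"
proof -
  have n: "sublinear (norm :: 'a \<Rightarrow> real)"
    using sublinear_norm_scaled[of 1, where ?'a = 'a] by simp
  obtain f where f: "linear f" "\<And>x. f x \<le> norm x"
    "\<And>k. k \<in> {t *\<^sub>R a |t. t \<ge> 0} \<Longrightarrow> norm k \<le> f k"
    using sublinear_sandwich[OF n superadditive_below_ray[OF n, of a]] by blast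
  obtain g :: "'a \<Rightarrow>\<^sub>L real" where g: "\<And>x. blinfun_apply g x = f x" "norm g \<le> 1"
    using blinfun_of_linear_le_norm[OF f(1), of 1] f(2) by auto
  have "a \<in> {t *\<^sub>R a |t. t \<ge> 0}" by (intro CollectI exI[of _ 1]) simp
  then have "f a = norm a" using f(2)[of a] f(3)[of a] by simp
  then show ?thesis using that g by simp
qed

lemma norm_preserving_extension:
  fixes h :: "'a::real_normed_vector \<Rightarrow>\<^sub>L real"
  assumes Y: "subspace Y" and "M \<ge> 0"
    and le: "\<And>y. y \<in> Y \<Longrightarrow> blinfun_apply h y \<le> M * norm y"
  obtains g :: "'a \<Rightarrow>\<^sub>L real" where "norm g \<le> M"
    "\<And>y. y \<in> Y \<Longrightarrow> blinfun_apply g y = blinfun_apply h y"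
proof -
  have "superadditive_below Y (blinfun_apply h) (\<lambda>x. M * norm x)"
    using Y le unfolding superadditive_below_def
    by (auto simp: subspace_0 subspace_add subspace_scale blinfun.add_right blinfun.scaleR_right)
  then obtain f where f: "linear f" "\<And>x. f x \<le> M * norm x"
    "\<And>y. y \<in> Y \<Longrightarrow> blinfun_apply h y \<le> f y"
    using sublinear_sandwich[OF sublinear_norm_scaled[OF \<open>M \<ge> 0\<close>]] by blast
  obtain g :: "'a \<Rightarrow>\<^sub>L real" where g: "\<And>x. blinfun_apply g x = f x" "norm g \<le> M"
    using blinfun_of_linear_le_norm[OF f(1,2) \<open>M \<ge> 0\<close>] by blast
  have "f y = blinfun_apply h y" if "y \<in> Y" for y
    (* The lower bound at - y is the upper bound at y. *)
    using f(3)[OF that] f(3)[of "- y"] subspace_neg[OF Y that] linear_neg[OF f(1), of y]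
    by (simp add: blinfun.minus_right)
  then show ?thesis using that g by simp
qed

section \<open>Weak* approximation of linear forms on the dual\<close>

text \<open>This is the bipolar theorem for the weak* topology: a linear form on the dual that respects
  every upper bound valid on \<open>C\<close> is a weak* limit of points of \<open>C\<close>. Goldstine's theorem is the case
  of the unit ball. If no point of \<open>C\<close> matched \<open>\<Phi>\<close> on \<open>F\<close>, then the squared distance
  \<open>\<Sum>f\<in>F. (\<Phi> f - f x)\<^sup>2\<close> would have a positive infimum \<open>d\<close>, and the direction from an almost
  nearest point \<open>x\<close> towards \<open>\<Phi>\<close> would be a functional separating \<open>\<Phi>\<close> from \<open>C\<close>. An almost nearest
  point is enough, so no compactness is involved.\<close>

lemma bipolar_approximation:
  fixes C :: "'a::real_normed_vector set" and \<Phi> :: "('a \<Rightarrow>\<^sub>L real) \<Rightarrow> real"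
  assumes C: "convex C" "C \<noteq> {}" "bounded C"
    and \<Phi>: "linear \<Phi>"
    and polar: "\<And>h M. (\<And>z. z \<in> C \<Longrightarrow> blinfun_apply h z \<le> M) \<Longrightarrow> \<Phi> h \<le> M"
    and F: "finite F" and "\<delta> > 0"
  shows "\<exists>x\<in>C. \<forall>f\<in>F. \<bar>blinfun_apply f x - \<Phi> f\<bar> < \<delta>"
proof (rule ccontr)
  assume far: "\<not> ?thesis"
  define \<phi> where "\<phi> x = (\<Sum>f\<in>F. (\<Phi> f - blinfun_apply f x)\<^sup>2)" for x
  define d where "d = (INF x\<in>C. \<phi> x)"
  have "\<delta>\<^sup>2 \<le> \<phi> x" if x: "x \<in> C" for x
  proof -
    obtain f where f: "f \<in> F" "\<not> \<bar>blinfun_apply f x - \<Phi> f\<bar> < \<delta>"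
      using far x by blast
    then have "\<delta>\<^sup>2 \<le> \<bar>blinfun_apply f x - \<Phi> f\<bar>\<^sup>2"
      using \<open>\<delta> > 0\<close> by (intro power_mono) auto
    also have "\<dots> = (\<Phi> f - blinfun_apply f x)\<^sup>2"
      by (simp add: power2_commute)
    also have "\<dots> \<le> \<phi> x"
      unfolding \<phi>_def using F f(1) by (intro member_le_sum) auto
    finally show ?thesis .
  qed
  then have "\<delta>\<^sup>2 \<le> d" unfolding d_def using C(2) by (intro cINF_greatest) auto
  then have d: "d > 0" using zero_less_power[OF \<open>\<delta> > 0\<close>, of 2] by linarith
  have dle: "d \<le> \<phi> x" if "x \<in> C" for x
    unfolding d_def using that
    by (intro cINF_lower bdd_belowI2[of _ 0]) (auto simp: \<phi>_def sum_nonneg)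
  obtain R where R: "\<And>x. x \<in> C \<Longrightarrow> norm x \<le> R"
    using C(3) by (auto simp: bounded_iff)
  define K where "K = (\<Sum>f\<in>F. (norm f * (2 * R))\<^sup>2)"
  have K: "K \<ge> 0" by (simp add: K_def sum_nonneg)
  (* The step length t makes the quadratic term of the expansion below small; the defect t * d
     of the almost nearest point x is chosen after it. *)
  define t where "t = min 1 (d / (2 * (K + 1)))"
  have t: "0 < t" "t \<le> 1" using d K by (auto simp: t_def)
  have tK: "t * K \<le> d / 2"
  proof -
    have "t * K \<le> d / (2 * (K + 1)) * K"
      using K by (intro mult_right_mono) (auto simp: t_def)
    also have "\<dots> = d / 2 * (K / (K + 1))" by simp
    also have "\<dots> \<le> d / 2 * 1" using K d by (intro mult_left_mono) auto
    also have "\<dots> = d / 2" by simp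
    finally show ?thesis .
  qed
  have "d < d + t * d" using t d by simp
  then obtain x where x: "x \<in> C" "\<phi> x < d + t * d"
    using cInf_lessD[of "\<phi> ` C" "d + t * d"] C(2) unfolding d_def by blast
  define h where "h = (\<Sum>f\<in>F. (\<Phi> f - blinfun_apply f x) *\<^sub>R f)"
  have h: "blinfun_apply h z = (\<Sum>f\<in>F. (\<Phi> f - blinfun_apply f x) * blinfun_apply f z)" for z
    by (simp add: h_def blinfun.sum_left blinfun.scaleR_left)
  have "blinfun_apply h z \<le> blinfun_apply h x + 3/4 * d" if z: "z \<in> C" for z
  proof -
    define v where "v = z - x"
    have quadratic: "(\<Sum>f\<in>F. (blinfun_apply f v)\<^sup>2) \<le> K"
      unfolding K_def
    proof (rule sum_mono)
      fix f :: "'a \<Rightarrow>\<^sub>L real"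
      have "norm v \<le> 2 * R"
        using norm_triangle_ineq4[of z x] R[OF z] R[OF x(1)] by (simp add: v_def)
      then have "norm (blinfun_apply f v) \<le> norm f * (2 * R)"
        by (meson mult_left_mono norm_blinfun norm_ge_zero order_trans)
      then show "(blinfun_apply f v)\<^sup>2 \<le> (norm f * (2 * R))\<^sup>2"
        using power_mono[of "\<bar>blinfun_apply f v\<bar>" "norm f * (2 * R)" 2] by simp
    qed
    have "(1 - t) *\<^sub>R x + t *\<^sub>R z \<in> C" using C(1) x(1) z t by (auto simp: convex_alt)
    moreover have "(1 - t) *\<^sub>R x + t *\<^sub>R z = x + t *\<^sub>R v" by (simp add: v_def algebra_simps)
    ultimately have "d \<le> \<phi> (x + t *\<^sub>R v)" by (intro dle) simp
    also have "\<dots> = (\<Sum>f\<in>F. (\<Phi> f - blinfun_apply f x)\<^sup>2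
        - 2 * t * ((\<Phi> f - blinfun_apply f x) * blinfun_apply f v)
        + t\<^sup>2 * (blinfun_apply f v)\<^sup>2)"
      unfolding \<phi>_def
      by (intro sum.cong refl)
        (simp add: blinfun.add_right blinfun.scaleR_right power2_eq_square algebra_simps)
    also have "\<dots> = \<phi> x - 2 * t * blinfun_apply h v + t\<^sup>2 * (\<Sum>f\<in>F. (blinfun_apply f v)\<^sup>2)"
      by (simp add: \<phi>_def h sum.distrib sum_subtractf sum_distrib_left)
    finally have "d \<le> \<phi> x - 2 * t * blinfun_apply h v + t\<^sup>2 * (\<Sum>f\<in>F. (blinfun_apply f v)\<^sup>2)" .
    moreover have "t\<^sup>2 * (\<Sum>f\<in>F. (blinfun_apply f v)\<^sup>2) \<le> t\<^sup>2 * K"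
      using quadratic by (intro mult_left_mono) auto
    ultimately have "d \<le> \<phi> x - 2 * t * blinfun_apply h v + t\<^sup>2 * K" by linarith
    with x(2) have "t * (2 * blinfun_apply h v) \<le> t * (d + t * K)"
      by (simp add: power2_eq_square algebra_simps)
    then have "2 * blinfun_apply h v \<le> d + t * K" using t by simp
    then show ?thesis using tK by (simp add: v_def blinfun.diff_right)
  qed
  then have "\<Phi> h \<le> blinfun_apply h x + 3/4 * d" by (rule polar)
  moreover have "\<Phi> h - blinfun_apply h x = \<phi> x"
  proof -
    have "\<Phi> h = (\<Sum>f\<in>F. (\<Phi> f - blinfun_apply f x) * \<Phi> f)"
      by (simp add: h_def linear_sum[OF \<Phi>] linear_cmul[OF \<Phi>])
    then show ?thesis
      by (simp add: h \<phi>_def power2_eq_square right_diff_distrib flip: sum_subtractf)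
  qed
  ultimately show False using dle[OF x(1)] d by simp
qed

section \<open>Basic neighbourhoods in the weak topology\<close>

lemma weakly_open_basic_neighbourhood:
  fixes V :: "'a::real_normed_vector set"
  assumes "openin (weak_topology_on UNIV) V" and "x\<^sub>0 \<in> V"
  obtains F :: "('a \<Rightarrow>\<^sub>L real) set" and \<delta>
  where "finite F" "\<delta> > 0"
    "\<And>x. (\<And>f. f \<in> F \<Longrightarrow> \<bar>blinfun_apply f x - blinfun_apply f x\<^sub>0\<bar> < \<delta>) \<Longrightarrow> x \<in> V"
proof -
  have "generate_topology_on {{x \<in> UNIV. f x \<in> V} | f V. f \<in> dual_on (UNIV::'a set) \<and> open V} V"
    using assms(1) unfolding weak_topology_on_def openin_topology_generated_by_iff .
  then have "\<exists>(F :: ('a \<Rightarrow>\<^sub>L real) set) \<delta>. finite F \<and> \<delta> > 0 \<and>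
    (\<forall>x. (\<forall>f\<in>F. \<bar>blinfun_apply f x - blinfun_apply f x\<^sub>0\<bar> < \<delta>) \<longrightarrow> x \<in> V)"
    using assms(2)
  proof induction
    case Empty
    then show ?case by simp
  next
    case (Int a b)
    then obtain F G \<delta> \<eta> where
      "finite (F :: ('a \<Rightarrow>\<^sub>L real) set)" "\<delta> > 0"
      "\<forall>x. (\<forall>f\<in>F. \<bar>blinfun_apply f x - blinfun_apply f x\<^sub>0\<bar> < \<delta>) \<longrightarrow> x \<in> a"
      "finite (G :: ('a \<Rightarrow>\<^sub>L real) set)" "\<eta> > 0"
      "\<forall>x. (\<forall>f\<in>G. \<bar>blinfun_apply f x - blinfun_apply f x\<^sub>0\<bar> < \<eta>) \<longrightarrow> x \<in> b"
      by auto
    then show ?case by (intro exI[of _ "F \<union> G"] exI[of _ "min \<delta> \<eta>"]) simp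
  next
    case (UN K)
    then show ?case by (meson UnionE UnionI)
  next
    case (Basis s)
    from Basis.hyps obtain f T where "f \<in> dual_on UNIV" and T: "open T" and s: "s = {x \<in> UNIV. f x \<in> T}"
      by blast
    then have f: "bounded_linear f" by (simp add: dual_on_UNIV)
    obtain \<delta> where "\<delta> > 0" "\<And>r. dist r (f x\<^sub>0) < \<delta> \<Longrightarrow> r \<in> T"
      using T s Basis.prems by (auto simp: open_dist)
    then show ?case
      using s bounded_linear_Blinfun_apply[OF f]
      by (intro exI[of _ "{Blinfun f}"] exI[of _ \<delta>]) (auto simp: dist_real_def)
  qed
  then show ?thesis using that by blast
qed

lemma openin_weak_slab:
  fixes c :: "('a::real_normed_vector \<Rightarrow>\<^sub>L real) \<Rightarrow> real"
  assumes "finite F"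
  shows "openin (weak_topology_on S) {y \<in> S. \<forall>f\<in>F. \<bar>blinfun_apply f y - c f\<bar> < \<delta>}"
  using assms
proof induction
  case empty
  show ?case using openin_topspace[of "weak_topology_on S"] by (simp add: topspace_weak_topology_on)
next
  case (insert f F)
  have "blinfun_apply f \<in> dual_on S"
    by (auto simp: dual_on_def blinfun.add_right blinfun.scaleR_right
        intro!: exI[of _ "norm f"] norm_blinfun[of f, simplified])
  then have "openin (weak_topology_on S) {y \<in> S. blinfun_apply f y \<in> ball (c f) \<delta>}"
    unfolding weak_topology_on_def by (intro topology_generated_by_Basis) blast
  from openin_Int[OF this insert.IH] show ?case
    by (rule back_subst[of "openin _"]) (auto simp: dist_real_def abs_minus_commute)
qed

section \<open>The ball huskable property passes to M-ideals\<close>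

text \<open>On the range of \<open>P\<close> the dual norm is the norm of the restriction to \<open>Y\<close>: \<open>P\<close> does not see the
  difference between \<open>h\<close> and a norm-preserving extension of its restriction.\<close>

lemma norm_L_projection_le_norm_on:
  fixes P :: "('a::real_normed_vector \<Rightarrow>\<^sub>L real) \<Rightarrow> ('a \<Rightarrow>\<^sub>L real)"
  assumes P: "L_projection P" "{f. P f = 0} = annihilator Y" and Y: "subspace Y"
    and le: "\<And>y. y \<in> Y \<Longrightarrow> norm y \<le> 1 \<Longrightarrow> blinfun_apply h y \<le> M"
  shows "norm (P h) \<le> M"
proof -
  have lin: "linear P" and split: "\<And>f. norm f = norm (P f) + norm (f - P f)"
    using P(1) unfolding L_projection_def by blast+
  have "M \<ge> 0" using le[OF subspace_0[OF Y]] by (simp add: blinfun.zero_right)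
  have "blinfun_apply h y \<le> M * norm y" if "y \<in> Y" for y
    using blinfun_apply_le_of_unit_ball[OF Y le that] .
  then obtain g :: "'a \<Rightarrow>\<^sub>L real" where g: "norm g \<le> M" "\<And>y. y \<in> Y \<Longrightarrow> blinfun_apply g y = blinfun_apply h y"
    using norm_preserving_extension[OF Y \<open>M \<ge> 0\<close>, of h] by blast
  have "g - h \<in> annihilator Y" using g(2) by (simp add: annihilator_def blinfun.diff_left)
  then have "P (g - h) = 0" using P(2) by blast
  then have "P g = P h" using linear_diff[OF lin, of g h] by simp
  then show ?thesis using split[of g] g(1) by (smt (verit) norm_ge_zero)
qed

theorem proposition2p5:
  fixes Y :: "'a::banach set"
  assumes "(UNIV :: 'a set) \<noteq> {0}"
    and "Y \<noteq> {0}"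
    and "M_ideal Y"
    and "BHP (UNIV :: 'a set)"
  shows "BHP Y"
  unfolding BHP_def
proof (intro allI impI)
  fix \<epsilon> :: real assume "\<epsilon> > 0"
  obtain P :: "('a \<Rightarrow>\<^sub>L real) \<Rightarrow> ('a \<Rightarrow>\<^sub>L real)" where Y: "subspace Y"
    and P: "L_projection P" "{f. P f = 0} = annihilator Y"
    using assms(3) by (auto simp: M_ideal_def)
  have lin: "linear P" and idem: "\<And>f. P (P f) = P f"
    and split: "\<And>f. norm f = norm (P f) + norm (f - P f)"
    using P(1) unfolding L_projection_def fun_eq_iff o_apply by blast+
  have P_on_Y: "blinfun_apply (P f) y = blinfun_apply f y" if "y \<in> Y" for f y
  proof -
    have "f - P f \<in> annihilator Y" using P(2) linear_diff[OF lin, of f "P f"] idem by auto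
    then show ?thesis using that by (simp add: annihilator_def blinfun.diff_left)
  qed
  have apply_le_norm: "blinfun_apply f x \<le> norm f" if "norm x \<le> 1" for f :: "'a \<Rightarrow>\<^sub>L real" and x
    using norm_blinfun[of f x] mult_left_mono[OF that, of "norm f"] by simp

  obtain U :: "'a set" where U: "openin (subtopology (weak_topology_on UNIV) (UNIV \<inter> cball 0 1)) U"
    "U \<noteq> {}" "diameter U < \<epsilon>"
    using assms(4) \<open>\<epsilon> > 0\<close> unfolding BHP_def by blast
  obtain V where V: "openin (weak_topology_on UNIV) V" "U = V \<inter> cball (0::'a) 1"
    using U(1) unfolding openin_subtopology Int_UNIV_left by blast
  obtain x\<^sub>0 where x0: "x\<^sub>0 \<in> V" "norm x\<^sub>0 \<le> 1" using U(2) V(2) by auto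
  obtain F :: "('a \<Rightarrow>\<^sub>L real) set" and \<delta> where F: "finite F" "\<delta> > 0"
    and nbhd: "\<And>x. (\<And>f. f \<in> F \<Longrightarrow> \<bar>blinfun_apply f x - blinfun_apply f x\<^sub>0\<bar> < \<delta>) \<Longrightarrow> x \<in> V"
    using weakly_open_basic_neighbourhood[OF V(1) x0(1)] by blast

  (* Half of the tolerance is left for approximating the elements of the bidual. *)
  define W where "W = {y \<in> Y. \<forall>f\<in>F. \<bar>blinfun_apply f y - blinfun_apply (P f) x\<^sub>0\<bar> < \<delta> / 2} \<inter> cball 0 1"
  have "openin (subtopology (weak_topology_on Y) (Y \<inter> cball 0 1)) W"
    unfolding openin_subtopology
  proof (intro exI conjI)
    show "openin (weak_topology_on Y)
        {y \<in> Y. \<forall>f\<in>F. \<bar>blinfun_apply f y - blinfun_apply (P f) x\<^sub>0\<bar> < \<delta> / 2}"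
      by (rule openin_weak_slab[OF F(1)])
    show "W = {y \<in> Y. \<forall>f\<in>F. \<bar>blinfun_apply f y - blinfun_apply (P f) x\<^sub>0\<bar> < \<delta> / 2}
        \<inter> (Y \<inter> cball 0 1)"
      unfolding W_def by blast
  qed
  moreover have "W \<noteq> {}"
  proof -
    have "\<exists>y\<in>Y \<inter> cball 0 1. \<forall>f\<in>F. \<bar>blinfun_apply f y - blinfun_apply (P f) x\<^sub>0\<bar> < \<delta> / 2"
    proof (rule bipolar_approximation)
      show "convex (Y \<inter> cball 0 1)" by (rule convex_Int[OF subspace_imp_convex[OF Y] convex_cball])
      show "Y \<inter> cball 0 1 \<noteq> {}" using subspace_0[OF Y] by force
      show "linear (\<lambda>f. blinfun_apply (P f) x\<^sub>0)"
        by (rule linearI)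
          (simp_all add: linear_add[OF lin] linear_cmul[OF lin] blinfun.add_left blinfun.scaleR_left)
      fix h :: "'a \<Rightarrow>\<^sub>L real" and M assume "\<And>z. z \<in> Y \<inter> cball 0 1 \<Longrightarrow> blinfun_apply h z \<le> M"
      then have "norm (P h) \<le> M" by (intro norm_L_projection_le_norm_on[OF P Y]) auto
      with apply_le_norm[OF x0(2), of "P h"] show "blinfun_apply (P h) x\<^sub>0 \<le> M" by linarith
    qed (use F in auto)
    then show ?thesis by (auto simp: W_def)
  qed
  moreover have "diameter W \<le> diameter U"
  proof (rule diameter_le)
    show "W \<noteq> {} \<or> 0 \<le> diameter U" using \<open>W \<noteq> {}\<close> by blast
    fix y z assume yz: "y \<in> W" "z \<in> W"
    obtain g :: "'a \<Rightarrow>\<^sub>L real" where g: "norm g \<le> 1" "blinfun_apply g (y - z) = norm (y - z)"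
      using norming_functional[of "y - z"] by blast
    (* The form approximated here is the element w + (I - P)* x0 of the bidual; its norm is at most 1
       because the dual is the l1-sum of the range and the kernel of P. *)
    have approx: "\<exists>x\<in>U. \<bar>blinfun_apply g x - (blinfun_apply g w + blinfun_apply (g - P g) x\<^sub>0)\<bar> < \<eta>"
      if w: "w \<in> W" and \<eta>: "\<eta> > 0" for w \<eta>
    proof -
      define \<Phi> where "\<Phi> f = blinfun_apply f w + blinfun_apply (f - P f) x\<^sub>0" for f
      have wY: "w \<in> Y" "norm w \<le> 1" using w by (auto simp: W_def)
      have "\<exists>x\<in>cball 0 1. \<forall>f\<in>insert g F. \<bar>blinfun_apply f x - \<Phi> f\<bar> < min \<eta> (\<delta> / 2)"
      proof (rule bipolar_approximation)
        show "linear \<Phi>"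
          unfolding \<Phi>_def
          by (rule linearI)
            (simp_all add: linear_add[OF lin] linear_cmul[OF lin] blinfun.add_left
              blinfun.diff_left blinfun.scaleR_left algebra_simps)
        fix h :: "'a \<Rightarrow>\<^sub>L real" and M assume h: "\<And>z. z \<in> cball 0 1 \<Longrightarrow> blinfun_apply h z \<le> M"
        have "M \<ge> 0" using h[of 0] by (simp add: blinfun.zero_right)
        have le: "blinfun_apply h x \<le> M * norm x" for x
          using blinfun_apply_le_of_unit_ball[OF subspace_UNIV, of h M x] h by simp
        have "norm h \<le> M"
        proof (rule norm_blinfun_bound[OF \<open>M \<ge> 0\<close>])
          show "norm (blinfun_apply h x) \<le> M * norm x" for x
            using le[of x] le[of "- x"] by (simp add: abs_le_iff blinfun.minus_right)
        qed
        have "\<Phi> h = blinfun_apply (P h) w + blinfun_apply (h - P h) x\<^sub>0"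
          using P_on_Y[OF wY(1)] by (simp add: \<Phi>_def)
        also have "\<dots> \<le> norm (P h) + norm (h - P h)"
          by (intro add_mono apply_le_norm wY x0)
        also have "\<dots> \<le> M" using split[of h] \<open>norm h \<le> M\<close> by simp
        finally show "\<Phi> h \<le> M" .
      qed (use F \<eta> in auto)
      then obtain x where x: "x \<in> cball 0 1"
        and close: "\<And>f. f \<in> insert g F \<Longrightarrow> \<bar>blinfun_apply f x - \<Phi> f\<bar> < min \<eta> (\<delta> / 2)"
        by blast
      have "x \<in> V"
      proof (rule nbhd)
        fix f assume f: "f \<in> F"
        have "\<Phi> f - blinfun_apply f x\<^sub>0 = blinfun_apply f w - blinfun_apply (P f) x\<^sub>0"
          by (simp add: \<Phi>_def blinfun.diff_left)
        moreover have "\<bar>blinfun_apply f w - blinfun_apply (P f) x\<^sub>0\<bar> < \<delta> / 2"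
          using w f by (simp add: W_def)
        moreover have "\<bar>blinfun_apply f x - \<Phi> f\<bar> < \<delta> / 2"
          using close[of f] f by simp
        ultimately show "\<bar>blinfun_apply f x - blinfun_apply f x\<^sub>0\<bar> < \<delta>" by linarith
      qed
      then show ?thesis using x close[of g] V(2) by (auto simp: \<Phi>_def)
    qed
    show "norm (y - z) \<le> diameter U"
    proof (rule field_le_epsilon)
      fix e :: real assume "e > 0"
      then have e: "e / 2 > 0" by simp
      obtain a b where a: "a \<in> U"
          "\<bar>blinfun_apply g a - (blinfun_apply g y + blinfun_apply (g - P g) x\<^sub>0)\<bar> < e / 2"
        and b: "b \<in> U"
          "\<bar>blinfun_apply g b - (blinfun_apply g z + blinfun_apply (g - P g) x\<^sub>0)\<bar> < e / 2"
        using approx[OF yz(1) e] approx[OF yz(2) e] by blast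
      have "norm (y - z) = blinfun_apply g y - blinfun_apply g z"
        using g(2) by (simp add: blinfun.diff_right)
      moreover have "blinfun_apply g y - blinfun_apply g z \<le> blinfun_apply g (a - b) + e"
        using a(2) b(2) unfolding blinfun.diff_right by linarith
      moreover have "blinfun_apply g (a - b) \<le> norm (a - b)"
        using norm_blinfun[of g "a - b"] mult_right_mono[OF g(1), of "norm (a - b)"] by simp
      moreover have "norm (a - b) \<le> diameter U"
      proof -
        have "bounded U" unfolding V(2) by (rule bounded_subset[OF bounded_cball Int_lower2])
        from diameter_bounded_bound[OF this a(1) b(1)] show ?thesis by (simp add: dist_norm)
      qed
      ultimately show "norm (y - z) \<le> diameter U + e" by linarith
    qed
  qed
  ultimately show "\<exists>U. openin (subtopology (weak_topology_on Y) (Y \<inter> cball 0 1)) U \<and>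
      U \<noteq> {} \<and> diameter U < \<epsilon>"
    using U(3) by (intro exI[of _ W]) simp
qed

end
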